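(* Let $\mathcal{G}=(\mathcal{V},\mathcal{E})$ be a network of $n$ agents with row-stochastic weighted adjacency matrix $W$, and let $\beta=\operatorname{diag}(\beta_1,\dots,\beta_n)$ with $\beta_i\in[0,1]$ be the stubbornness matrix, exactly $m$ of the agents being stubborn (that is, having $\beta_i>0$). Let the opinions $\mathbf{x}(k)\in\mathbb{R}^n$ evolve by the Friedkin-Johnsen model $\mathbf{x}(k+1)=(I-\beta)W\mathbf{x}(k)+\beta\mathbf{x}(0)$, $k\ge 0$. Suppose that each iSCC of $\mathcal{G}$ composed of oblivious agents is aperiodic. Let $p$ be an LTP agent of $\mathcal{G}$ and let $\mathcal{N}_p$ be the set of non-influential agents persuaded by $p$. Then $\{p\}\cup\mathcal{N}_p$ forms an opinion cluster: for every initial condition $\mathbf{x}(0)\in\mathbb{R}^n$, the final opinions satisfy $x_i^*=x_j^*$ for all $i,j\in\{p\}\cup\mathcal{N}_p$.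
   Context: Graph conventions. $\mathcal{V}=\{1,\dots,n\}$ is the set of agents and $\mathcal{E}\subseteq\mathcal{V}\times\mathcal{V}$ the set of directed edges (self-loops allowed); an edge $(i,j)\in\mathcal{E}$ means that $i$ is an in-neighbour of $j$. The weighted adjacency matrix $W=[w_{ij}]\in\mathbb{R}^{n\times n}$ has $w_{ij}>0$ if $(j,i)\in\mathcal{E}$ and $w_{ij}=0$ otherwise; it is row-stochastic (each row sums to $1$). A walk is an ordered sequence of nodes in which each pair of consecutive nodes is an edge; a path is a (directed) walk with no repeated nodes; a cycle is a walk whose initial and final nodes coincide. A path traverses a node if that node occurs on it, endpoints included. A (sub)graph is aperiodic if the lengths of all its cycles are coprime (have greatest common divisor $1$). A strongly connected component (SCC) is a maximal strongly connected subgraph. An SCC is an independent strongly connected component (iSCC) if every node in it has all its in-neighbours within the same SCC. Agents. Agent $i$ is stubborn if $\beta_i>0$. An agent is oblivious if it is non-stubborn and there is no directed path to it from any stubborn agent. The influential agents are the stubborn agents together with the oblivious agents that belong to iSCCs; $\mathcal{I}$ denotes the set of influential agents. For a non-influential agent $q\in\mathcal{V}\setminus\mathcal{I}$, $\mathcal{I}_q\subseteq\mathcal{I}$ denotes the set of influential agents that have a directed path to $q$. LTP agents. An agent $p\in\mathcal{V}$ is a Locally Topologically Persuasive (LTP) agent if: (i) there exists an agent $q\in\mathcal{V}\setminus\mathcal{I}$, $q\ne p$, such that every path in $\mathcal{G}$ from each influential agent $s\in\mathcal{I}_q$ to $q$ traverses $p$; and (ii) additionally, if $p\in\mathcal{V}\setminus\mathcal{I}$,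 there does not exist an agent $c\in\mathcal{V}$, $c\neq p$, such that all paths from each agent $s\in\mathcal{I}_p$ to $p$ traverse $c$. For an LTP agent $p$, a non-influential agent $q\neq p$ satisfying the condition in (i) is said to be persuaded by $p$, and $\mathcal{N}_p$ denotes the set of all non-influential agents persuaded by $p$. Final opinions. $x_i^*=\lim_{k\to\infty}x_i(k)$ denotes the final opinion of agent $i$; it is a known result that, under the stated aperiodicity hypothesis, this limit exists for every $\mathbf{x}(0)$. *)

theory Defs
  imports
    "HOL-Analysis.Analysis"
    "Graph_Theory.Digraph_Component"
begin

text \<open>
  The agents are the elements of a finite type \<open>'n\<close>, so \<open>n = CARD('n)\<close>. An edge \<open>(i, j)\<close> is read
  as: \<open>i\<close> is an in-neighbour of \<open>j\<close>. Self-loops are allowed.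
\<close>

definition network :: "('n \<times> 'n) set \<Rightarrow> ('n, 'n \<times> 'n) pre_digraph" where
  "network E = \<lparr>verts = UNIV, arcs = E, tail = fst, head = snd\<rparr>"

text \<open>Edges are reversed: \<open>W $ i $ j\<close> is the weight that \<open>i\<close> gives to its in-neighbour \<open>j\<close>.\<close>

definition weighted_adjacency :: "('n::finite \<times> 'n) set \<Rightarrow> real^'n^'n \<Rightarrow> bool" where
  "weighted_adjacency E W \<longleftrightarrow>
     (\<forall>i j. if (j, i) \<in> E then W $ i $ j > 0 else W $ i $ j = 0)"

definition row_stochastic :: "real^'n^'n::finite \<Rightarrow> bool" where
  "row_stochastic W \<longleftrightarrow> (\<forall>i j. 0 \<le> W $ i $ j) \<and> (\<forall>i. (\<Sum>j\<in>UNIV. W $ i $ j) = 1)"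

definition path_between :: "('n \<times> 'n) set \<Rightarrow> 'n \<Rightarrow> ('n \<times> 'n) list \<Rightarrow> 'n \<Rightarrow> bool" where
  "path_between E u \<pi> v \<longleftrightarrow> pre_digraph.apath (network E) u \<pi> v"

definition has_path :: "('n \<times> 'n) set \<Rightarrow> 'n \<Rightarrow> 'n \<Rightarrow> bool" where
  "has_path E u v \<longleftrightarrow> (\<exists>\<pi>. path_between E u \<pi> v)"

text \<open>
  The start node \<open>u\<close> is needed because a path is a list of edges, empty if \<open>u\<close> is also the end node.
\<close>

definition traverses :: "('n \<times> 'n) set \<Rightarrow> 'n \<Rightarrow> ('n \<times> 'n) list \<Rightarrow> 'n \<Rightarrow> bool" where
  "traverses E u \<pi> p \<longleftrightarrow> p \<in> set (pre_digraph.awalk_verts (network E) u \<pi>)"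

text \<open>
  Cycles are closed walks that may repeat nodes, unlike those of \<^const>\<open>pre_digraph.cycle\<close>.
  A graph without cycles is not aperiodic, since \<open>Gcd {} = 0\<close>.
\<close>

definition aperiodic :: "('a, 'b) pre_digraph \<Rightarrow> bool" where
  "aperiodic H \<longleftrightarrow> Gcd {length c | c. \<exists>u. pre_digraph.awalk H u c u \<and> c \<noteq> []} = 1"

definition isccs :: "('n \<times> 'n) set \<Rightarrow> ('n, 'n \<times> 'n) pre_digraph set" where
  "isccs E = {H \<in> pre_digraph.sccs (network E). \<forall>j\<in>verts H. \<forall>i. (i, j) \<in> E \<longrightarrow> i \<in> verts H}"

definition stubborn :: "real^'n \<Rightarrow> 'n::finite set" where
  "stubborn \<beta> = {i. \<beta> $ i > 0}"

definition oblivious :: "('n \<times> 'n) set \<Rightarrow> real^'n \<Rightarrow> 'n::finite set" where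
  "oblivious E \<beta> = {i. i \<notin> stubborn \<beta> \<and> (\<forall>s\<in>stubborn \<beta>. \<not> has_path E s i)}"

definition influential :: "('n \<times> 'n) set \<Rightarrow> real^'n \<Rightarrow> 'n::finite set" where
  "influential E \<beta> = stubborn \<beta> \<union> {i \<in> oblivious E \<beta>. \<exists>H\<in>isccs E. i \<in> verts H}"

definition influencers :: "('n \<times> 'n) set \<Rightarrow> real^'n \<Rightarrow> 'n \<Rightarrow> 'n::finite set" where
  "influencers E \<beta> q = {s \<in> influential E \<beta>. has_path E s q}"

definition all_paths_traverse :: "('n \<times> 'n) set \<Rightarrow> real^'n \<Rightarrow> 'n::finite \<Rightarrow> 'n \<Rightarrow> bool" where
  "all_paths_traverse E \<beta> q p \<longleftrightarrow>
     (\<forall>s\<in>influencers E \<beta> q. \<forall>\<pi>. path_between E s \<pi> q \<longrightarrow> traverses E s \<pi> p)"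

definition persuaded :: "('n \<times> 'n) set \<Rightarrow> real^'n \<Rightarrow> 'n::finite \<Rightarrow> 'n set" where
  "persuaded E \<beta> p = {q. q \<notin> influential E \<beta> \<and> q \<noteq> p \<and> all_paths_traverse E \<beta> q p}"

definition LTP_agent :: "('n \<times> 'n) set \<Rightarrow> real^'n \<Rightarrow> 'n::finite \<Rightarrow> bool" where
  "LTP_agent E \<beta> p \<longleftrightarrow>
     (\<exists>q. q \<notin> influential E \<beta> \<and> q \<noteq> p \<and> all_paths_traverse E \<beta> q p) \<and>
     (p \<notin> influential E \<beta> \<longrightarrow> \<not> (\<exists>c. c \<noteq> p \<and> all_paths_traverse E \<beta> p c))"

definition diag_matrix :: "real^'n \<Rightarrow> real^'n^'n::finite" where
  "diag_matrix \<beta> = (\<chi> i j. if i = j then \<beta> $ i else 0)"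

primrec FJ_opinion :: "real^'n^'n \<Rightarrow> real^'n \<Rightarrow> real^'n \<Rightarrow> nat \<Rightarrow> real^'n::finite" where
  "FJ_opinion W \<beta> x0 0 = x0"
| "FJ_opinion W \<beta> x0 (Suc k) =
     ((mat 1 - diag_matrix \<beta>) ** W) *v FJ_opinion W \<beta> x0 k + diag_matrix \<beta> *v x0"

definition final_opinion :: "real^'n^'n \<Rightarrow> real^'n \<Rightarrow> real^'n \<Rightarrow> 'n::finite \<Rightarrow> real" where
  "final_opinion W \<beta> x0 i = lim (\<lambda>k. FJ_opinion W \<beta> x0 k $ i)"

text \<open>
  Convergence is part of the notion because \<^const>\<open>lim\<close> is a total function: without it, two
  divergent opinions would have equal, meaningless final values.
\<close>

definition opinion_cluster :: "real^'n^'n \<Rightarrow> real^'n \<Rightarrow> 'n::finite set \<Rightarrow> bool" where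
  "opinion_cluster W \<beta> C \<longleftrightarrow>
     (\<forall>x0. (\<forall>i\<in>C. convergent (\<lambda>k. FJ_opinion W \<beta> x0 k $ i)) \<and>
           (\<forall>i\<in>C. \<forall>j\<in>C. final_opinion W \<beta> x0 i = final_opinion W \<beta> x0 j))"

end

theory Submission
  imports Defs
begin

text \<open>
  Let \<open>D\<^sub>i\<close> be the limit, as \<open>k\<close> grows, of the oscillation of the opinion of \<open>i\<close> after time \<open>k\<close>. Then
  \<open>D\<^sub>i \<le> (1 - \<beta>\<^sub>i) \<Sum>\<^sub>j w\<^sub>i\<^sub>j D\<^sub>j\<close>, so if \<open>D\<close> had a positive maximum, the set where it is attained would
  contain no stubborn agent and would be closed under in-neighbours. Every nonempty set closed under
  in-neighbours contains an iSCC; here it is oblivious and aperiodic, so that some power of its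
  weight matrix is positive and its opinions converge, contradicting \<open>D > 0\<close>. Hence all opinions
  converge.

  All in-neighbours of an agent persuaded by \<open>p\<close> are \<open>p\<close> itself or again persuaded by \<open>p\<close>. On the
  persuaded agents the final opinions are averages over in-neighbours; if their maximum
  exceeded the final opinion of \<open>p\<close>, the maximisers would be closed under in-neighbours, hence
  contain an iSCC and with it an influential agent, although persuaded agents are not influential.
  The same applies to the minimum.
\<close>

section \<open>Paths, walks and independent components\<close>

lemma network_simps [simp]:
  "verts (network E) = UNIV" "arcs (network E) = E" "tail (network E) = fst" "head (network E) = snd"
  by (simp_all add: network_def)

lemma wf_digraph_network: "wf_digraph (network E)"
  by unfold_locales auto

definition pred_closed :: "('n \<times> 'n) set \<Rightarrow> 'n set \<Rightarrow> bool" where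
  "pred_closed E S \<longleftrightarrow> (\<forall>i j. (i, j) \<in> E \<longrightarrow> j \<in> S \<longrightarrow> i \<in> S)"

lemma pred_closedD: "pred_closed E S \<Longrightarrow> (i, j) \<in> E \<Longrightarrow> j \<in> S \<Longrightarrow> i \<in> S"
  by (auto simp: pred_closed_def)

lemma pred_closed_rtrancl:
  assumes "pred_closed E S" "(u, v) \<in> E\<^sup>*" "v \<in> S"
  shows "u \<in> S"
  using assms(2,3)
  by (induction rule: converse_rtrancl_induct) (auto intro: pred_closedD[OF assms(1)])

text \<open>The graph \<open>H\<close> need not be \<open>network E\<close> itself: the lemma also
  serves induced subgraphs, whose cycles are then closed walks of \<open>E\<close>. The length is
  kept because it matters for aperiodicity.\<close>

lemma awalk_imp_relpow:
  assumes "pre_digraph.awalk H u c v" "arcs H \<subseteq> E" "tail H = fst" "head H = snd"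
  shows "(u, v) \<in> E ^^ length c"
proof -
  have "pre_digraph.cas H u c v" "set c \<subseteq> arcs H"
    using assms(1) by (auto simp: pre_digraph.awalk_def)
  then show ?thesis
  proof (induction c arbitrary: u)
    case Nil
    then show ?case by (simp add: pre_digraph.cas.simps)
  next
    case (Cons e c)
    then have "(u, snd e) \<in> E" "(snd e, v) \<in> E ^^ length c"
      using assms(2-) by (auto simp: pre_digraph.cas.simps)
    then show ?case unfolding list.size(4) add_Suc_right add_0_right by (rule relpow_Suc_I2)
  qed
qed

lemma reachable_network_iff: "u \<rightarrow>\<^sup>*\<^bsub>network E\<^esub> v \<longleftrightarrow> (u, v) \<in> E\<^sup>*"
proof -
  interpret wf_digraph "network E" by (rule wf_digraph_network)
  show ?thesis
  proof
    assume "u \<rightarrow>\<^sup>*\<^bsub>network E\<^esub> v"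
    then obtain c where "awalk u c v" by (auto simp: reachable_awalk)
    then show "(u, v) \<in> E\<^sup>*"
      using awalk_imp_relpow[of "network E" u c v E] by (auto intro: relpow_imp_rtrancl)
  next
    assume "(u, v) \<in> E\<^sup>*"
    then show "u \<rightarrow>\<^sup>*\<^bsub>network E\<^esub> v"
    proof (induction rule: rtrancl_induct)
      case base
      show ?case by simp
    next
      case (step y z)
      have "y \<rightarrow>\<^bsub>network E\<^esub> z" using step(2) by (force simp: arcs_ends_def arc_to_ends_def)
      then show ?case using step(3) by (rule reachable_adj_trans[rotated])
    qed
  qed
qed

lemma has_path_iff: "has_path E u v \<longleftrightarrow> (u, v) \<in> E\<^sup>*"
proof -
  interpret wf_digraph "network E" by (rule wf_digraph_network)
  show ?thesis
    by (simp add: has_path_def path_between_def reachable_apath flip: reachable_network_iff)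
qed

text \<open>Take \<open>v\<close> in \<open>S\<close> with the fewest ancestors. An ancestor
  \<open>u\<close> of \<open>v\<close> lies in \<open>S\<close> and its ancestors are among those of
  \<open>v\<close>; minimality forces the two ancestor sets to agree, so \<open>v\<close> also
  reaches \<open>u\<close>. Hence \<open>anc v\<close> is strongly connected, and as an ancestor set
  it is closed under in-neighbours.\<close>

lemma pred_closed_contains_iscc:
  fixes E :: "('n::finite \<times> 'n) set"
  assumes "pred_closed E S" "S \<noteq> {}"
  obtains C where "network E \<restriction> C \<in> isccs E" "C \<subseteq> S" "C \<noteq> {}" "pred_closed E C"
    "\<And>u v. u \<in> C \<Longrightarrow> v \<in> C \<Longrightarrow> (u, v) \<in> E\<^sup>*"
proof -
  interpret wf_digraph "network E" by (rule wf_digraph_network)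
  define anc where "anc v = {u. (u, v) \<in> E\<^sup>*}" for v
  obtain v where v: "v \<in> S" "\<And>u. u \<in> S \<Longrightarrow> card (anc v) \<le> card (anc u)"
    using ex_has_least_nat[of "\<lambda>v. v \<in> S" _ "\<lambda>v. card (anc v)"] assms(2) by blast
  have anc_v: "(v, u) \<in> E\<^sup>*" if "u \<in> anc v" for u
  proof -
    have "u \<in> S" using that v(1) pred_closed_rtrancl[OF assms(1)] by (auto simp: anc_def)
    moreover have "anc u \<subseteq> anc v" using that by (auto simp: anc_def)
    ultimately have "anc u = anc v" using v(2) by (intro card_seteq) auto
    then show ?thesis by (auto simp: anc_def)
  qed
  have conn: "(x, y) \<in> E\<^sup>*" if "x \<in> anc v" "y \<in> anc v" for x y
    using that anc_v[of y] by (auto simp: anc_def)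
  have closed: "pred_closed E (anc v)"
    by (auto simp: pred_closed_def anc_def)
  have "scc_of v = anc v"
    using anc_v by (auto simp: scc_of_def reachable_network_iff anc_def)
  then have "network E \<restriction> anc v \<in> sccs"
    using scc_of_in_sccs_verts[of v] in_sccs_verts_conv by simp
  then have "network E \<restriction> anc v \<in> isccs E"
    using closed by (auto simp: isccs_def pred_closed_def)
  moreover have "anc v \<subseteq> S"
    using v(1) pred_closed_rtrancl[OF assms(1)] by (auto simp: anc_def)
  moreover have "v \<in> anc v" by (simp add: anc_def)
  ultimately show ?thesis using that conn closed by blast
qed

lemma pred_closed_oblivious:
  assumes "pred_closed E C" "C \<inter> stubborn \<beta> = {}"
  shows "C \<subseteq> oblivious E \<beta>"
  using assms pred_closed_rtrancl[OF assms(1)] by (auto simp: oblivious_def has_path_iff)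

text \<open>An iSCC inside \<open>S\<close> either contains a stubborn agent or consists of
  oblivious agents; in both cases it has an influential member.\<close>

lemma pred_closed_contains_influential:
  fixes E :: "('n::finite \<times> 'n) set"
  assumes "pred_closed E S" "S \<noteq> {}"
  shows "S \<inter> influential E \<beta> \<noteq> {}"
proof -
  obtain C where C: "network E \<restriction> C \<in> isccs E" "C \<subseteq> S" "C \<noteq> {}" "pred_closed E C"
    using pred_closed_contains_iscc[OF assms] by metis
  show ?thesis
  proof (cases "C \<inter> stubborn \<beta> = {}")
    case True
    then have "C \<subseteq> oblivious E \<beta>" by (rule pred_closed_oblivious[OF C(4)])
    moreover obtain c where "c \<in> C" using C(3) by blast
    moreover have "c \<in> verts (network E \<restriction> C)" using \<open>c \<in> C\<close> by simp
    ultimately have "c \<in> influential E \<beta>" using C(1) unfolding influential_def by blast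
    then show ?thesis using \<open>c \<in> C\<close> C(2) by blast
  next
    case False
    then show ?thesis using C by (auto simp: influential_def)
  qed
qed

text \<open>Otherwise some path from an influential agent to \<open>r\<close> avoids
  \<open>p\<close>; prolonging it by the edge to \<open>q\<close> yields a path to \<open>q\<close>
  that still avoids \<open>p\<close>.\<close>

lemma in_neighbour_persuaded:
  assumes q: "q \<in> persuaded E \<beta> p" and e: "(r, q) \<in> E"
  shows "r \<in> insert p (persuaded E \<beta> p)"
proof (rule ccontr)
  interpret wf_digraph "network E" by (rule wf_digraph_network)
  assume "r \<notin> insert p (persuaded E \<beta> p)"
  then have r: "r \<noteq> p" "r \<in> influential E \<beta> \<or> \<not> all_paths_traverse E \<beta> r p"
    by (auto simp: persuaded_def)
  obtain s \<pi> where s: "s \<in> influential E \<beta>" "apath s \<pi> r" "p \<notin> set (awalk_verts s \<pi>)"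
  proof (cases "r \<in> influential E \<beta>")
    case True
    \<comment> \<open>An influential \<open>r\<close> is its own source, by the empty path.\<close>
    then show ?thesis using that[of r "[]"] r by (auto simp: apath_def awalk_Nil_iff)
  next
    case False
    then show ?thesis
      using r that by (auto simp: all_paths_traverse_def influencers_def path_between_def traverses_def)
  qed
  have qp: "q \<noteq> p" "all_paths_traverse E \<beta> q p" using q by (auto simp: persuaded_def)
  have aw: "awalk s \<pi> r" using s(2) by (simp add: apath_def)
  have "awalk r [(r, q)] q" using e by (simp add: awalk_Cons_iff awalk_Nil_iff)
  then have w: "awalk s (\<pi> @ [(r, q)]) q" using aw by (rule awalk_appendI[rotated])
  \<comment> \<open>The prolonged walk may visit \<open>q\<close> twice. Cutting out loops only
    removes edges, so no new node, in particular not \<open>p\<close>, appears.\<close>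
  define \<rho> where "\<rho> = awalk_to_apath (\<pi> @ [(r, q)])"
  have \<rho>: "apath s \<rho> q" "set \<rho> \<subseteq> set (\<pi> @ [(r, q)])"
    using apath_awalk_to_apath[OF w] awalk_to_apath_subset[OF w] by (auto simp: \<rho>_def)
  have "p \<notin> set (awalk_verts s \<rho>)"
    using set_awalk_verts[OF aw] set_awalk_verts[of s \<rho> q] \<rho> s(3) r(1) qp(1)
    by (auto simp: apath_def)
  moreover have "s \<in> influencers E \<beta> q"
    using s(1) \<rho>(1) by (auto simp: influencers_def has_path_def path_between_def)
  ultimately show False
    using qp(2) \<rho>(1) by (auto simp: all_paths_traverse_def path_between_def traverses_def)
qed

section \<open>Aperiodic strongly connected sets\<close>

text \<open>A numerical semigroup with gcd 1 contains all large numbers. The least positive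
  difference \<open>d\<close> of two elements divides every element, hence is 1, and two consecutive
  elements \<open>a\<close> and \<open>a + 1\<close> generate every
  \<open>n \<ge> a * a\<close>.\<close>

lemma additive_set_eventually:
  fixes S :: "nat set"
  assumes zero: "0 \<in> S" and add: "\<And>a b. a \<in> S \<Longrightarrow> b \<in> S \<Longrightarrow> a + b \<in> S" and gcd: "Gcd S = 1"
  obtains K where "\<And>n. n \<ge> K \<Longrightarrow> n \<in> S"
proof -
  have mult: "q * a \<in> S" if "a \<in> S" for q a
    by (induction q) (auto simp: zero add that)
  define P where "P d \<longleftrightarrow> d > 0 \<and> (\<exists>a\<in>S. a + d \<in> S)" for d
  define d where "d = (LEAST d. P d)"
  have "\<exists>s\<in>S. s > 0"
    using gcd Gcd_0_iff[of S] by (cases "S \<subseteq> {0}") auto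
  then have "\<exists>d. P d" using zero by (auto simp: P_def intro!: bexI[of _ 0])
  then have "P d" unfolding d_def by (rule LeastI_ex)
  then obtain a where a: "a \<in> S" "a + d \<in> S" "d > 0" by (auto simp: P_def)
  have "d dvd s" if "s \<in> S" for s
  proof (rule ccontr)
    assume "\<not> d dvd s"
    then have r: "s mod d > 0" by (simp add: dvd_eq_mod_eq_0)
    \<comment> \<open>Both \<open>s div d * (a + d)\<close> and \<open>s div d * a + s\<close> lie
      in \<open>S\<close>, so a nonzero remainder would be a difference smaller than
      \<open>d\<close>.\<close>
    have "s div d * (a + d) + s mod d = s div d * a + s"
      by (simp add: algebra_simps)
    then have "P (s mod d)"
      using r mult[OF a(2)] add[OF mult[OF a(1)] that] unfolding P_def by metis
    then have "d \<le> s mod d" unfolding d_def by (rule Least_le)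
    with a(3) show False using mod_less_divisor leD by blast
  qed
  then have "d dvd Gcd S" by (rule Gcd_greatest)
  then have d1: "d = 1" using gcd by simp
  have "n \<in> S" if n: "n \<ge> a * a" for n
  proof (cases "a = 0")
    case True
    then show ?thesis using mult[OF a(2), of n] d1 by simp
  next
    case False
    have "a \<le> n div a" using n False by (simp add: less_eq_div_iff_mult_less_eq)
    moreover have "n mod a < a" using False by simp
    ultimately have le: "n mod a \<le> n div a" by linarith
    \<comment> \<open>Of the \<open>n div a\<close> summands, \<open>n mod a\<close> are taken to be
      \<open>a + 1\<close> and the others \<open>a\<close>.\<close>
    have "(n div a - n mod a) * a + n mod a * (a + d) = (n div a - n mod a + n mod a) * a + n mod a"
      unfolding d1 by (simp only: algebra_simps)
    also have "\<dots> = n" using le by simp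
    finally show ?thesis using add[OF mult[OF a(1)] mult[OF a(2)]] by metis
  qed
  then show ?thesis using that by blast
qed

lemma relpow_trans: "(x, y) \<in> R ^^ m \<Longrightarrow> (y, z) \<in> R ^^ n \<Longrightarrow> (x, z) \<in> R ^^ (m + n)"
  by (auto simp: relpow_add)

text \<open>Fix \<open>u\<close> in \<open>C\<close>. A closed walk of length \<open>k\<close> at
  \<open>v\<close> can be inserted into a round trip from \<open>u\<close> through \<open>v\<close>,
  so the gcd of the return times to \<open>u\<close> divides \<open>k\<close>. These return times
  thus have gcd 1 and include all large numbers; fixed walks to and from \<open>u\<close> carry this
  over to all pairs.\<close>

lemma aperiodic_imp_primitive:
  fixes E :: "('n::finite \<times> 'n) set"
  assumes conn: "\<And>u v. u \<in> C \<Longrightarrow> v \<in> C \<Longrightarrow> (u, v) \<in> E\<^sup>*" and "C \<noteq> {}"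
    and gcd: "Gcd {k. \<exists>v\<in>C. (v, v) \<in> E ^^ k} = 1"
  obtains N where "\<And>i j. i \<in> C \<Longrightarrow> j \<in> C \<Longrightarrow> (i, j) \<in> E ^^ N"
proof -
  obtain u where u: "u \<in> C" using assms by auto
  define S where "S = {k. (u, u) \<in> E ^^ k}"
  have len: "\<exists>a. (x, y) \<in> E ^^ a" if "x \<in> C" "y \<in> C" for x y
    using conn[OF that] by (rule rtrancl_imp_relpow)
  have "Gcd S dvd k" if k: "v \<in> C" "(v, v) \<in> E ^^ k" for v k
  proof -
    obtain a b where ab: "(u, v) \<in> E ^^ a" "(v, u) \<in> E ^^ b" using len u k(1) by blast
    have "a + b \<in> S" "a + k + b \<in> S"
      using relpow_trans[OF ab] relpow_trans[OF relpow_trans[OF ab(1) k(2)] ab(2)]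
      by (simp_all add: S_def)
    then have "Gcd S dvd a + b" "Gcd S dvd (a + b) + k"
      by (simp_all add: Gcd_dvd algebra_simps)
    then show ?thesis by (simp add: dvd_add_right_iff)
  qed
  then have "Gcd S dvd Gcd {k. \<exists>v\<in>C. (v, v) \<in> E ^^ k}" by (intro Gcd_greatest) auto
  then have "Gcd S = 1" using gcd by simp
  then obtain K where K: "\<And>n. n \<ge> K \<Longrightarrow> n \<in> S"
    using additive_set_eventually[of S] relpow_trans[of u u _ E] unfolding S_def by auto
  have "\<exists>L. \<forall>n\<ge>L. (i, j) \<in> E ^^ n" if ij: "i \<in> C" "j \<in> C" for i j
  proof -
    obtain a b where ab: "(i, u) \<in> E ^^ a" "(u, j) \<in> E ^^ b" using len u ij by blast
    have "(i, j) \<in> E ^^ n" if "n \<ge> a + K + b" for n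
    proof -
      have "(u, u) \<in> E ^^ (n - a - b)" using K[of "n - a - b"] that by (simp add: S_def)
      then have "(i, j) \<in> E ^^ (a + (n - a - b) + b)"
        by (rule relpow_trans[OF relpow_trans[OF ab(1)] ab(2)])
      then show ?thesis using that by simp
    qed
    then show ?thesis by blast
  qed
  then obtain L where L: "\<And>i j n. i \<in> C \<Longrightarrow> j \<in> C \<Longrightarrow> n \<ge> L i j \<Longrightarrow> (i, j) \<in> E ^^ n"
    by metis
  \<comment> \<open>The sum of all thresholds serves as one exponent that exceeds each of
    them.\<close>
  have "(i, j) \<in> E ^^ (\<Sum>i\<in>UNIV. \<Sum>j\<in>UNIV. L i j)" if "i \<in> C" "j \<in> C" for i j
  proof (rule L[OF that])
    have "L i j \<le> (\<Sum>j\<in>UNIV. L i j)" by (rule member_le_sum) auto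
    also have "\<dots> \<le> (\<Sum>i\<in>UNIV. \<Sum>j\<in>UNIV. L i j)"
      by (rule member_le_sum[of i UNIV "\<lambda>i. \<Sum>j\<in>UNIV. L i j"]) auto
    finally show "L i j \<le> (\<Sum>i\<in>UNIV. \<Sum>j\<in>UNIV. L i j)" .
  qed
  then show ?thesis using that by blast
qed

section \<open>Averaging\<close>

text \<open>A bound at the in-neighbours suffices, since all other weights vanish.\<close>

lemma row_stochastic_sum_le:
  fixes W :: "real^'n::finite^'n"
  assumes "weighted_adjacency E W" "row_stochastic W" "\<And>j. (j, i) \<in> E \<Longrightarrow> y j \<le> M"
  shows "(\<Sum>j\<in>UNIV. W $ i $ j * y j) \<le> M"
proof -
  have "(\<Sum>j\<in>UNIV. W $ i $ j * y j) \<le> (\<Sum>j\<in>UNIV. W $ i $ j * M)"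
  proof (rule sum_mono)
    fix j
    show "W $ i $ j * y j \<le> W $ i $ j * M"
      using assms unfolding weighted_adjacency_def row_stochastic_def
      by (cases "(j, i) \<in> E") (auto intro: mult_left_mono)
  qed
  also have "\<dots> = M" using assms(2) by (simp add: row_stochastic_def flip: sum_distrib_right)
  finally show ?thesis .
qed

text \<open>The gap between \<open>M\<close> and the average is the average of the gaps
  \<open>M - y j\<close>, all nonnegative where the weight is positive, hence at least any single
  term.\<close>

lemma row_stochastic_sum_le_strict:
  fixes W :: "real^'n::finite^'n"
  assumes adj: "weighted_adjacency E W" and rs: "row_stochastic W"
    and le: "\<And>j. (j, i) \<in> E \<Longrightarrow> y j \<le> M" and l: "(l, i) \<in> E"
  shows "(\<Sum>j\<in>UNIV. W $ i $ j * y j) \<le> M - W $ i $ l * (M - y l)"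
proof -
  have nn: "0 \<le> W $ i $ j * (M - y j)" for j
    using adj rs le[of j] unfolding weighted_adjacency_def row_stochastic_def
    by (cases "(j, i) \<in> E") auto
  have "W $ i $ l * (M - y l) \<le> (\<Sum>j\<in>UNIV. W $ i $ j * (M - y j))"
    by (rule member_le_sum) (use nn in auto)
  also have "\<dots> = M - (\<Sum>j\<in>UNIV. W $ i $ j * y j)"
    using rs by (simp add: row_stochastic_def right_diff_distrib sum_subtractf flip: sum_distrib_right)
  finally show ?thesis by simp
qed

text \<open>The maximum principle: it makes sets of maximisers closed under in-neighbours.\<close>

lemma row_stochastic_sum_max_eq:
  fixes W :: "real^'n::finite^'n"
  assumes adj: "weighted_adjacency E W" and rs: "row_stochastic W"
    and le: "\<And>j. (j, i) \<in> E \<Longrightarrow> y j \<le> M" and M: "M \<le> (\<Sum>j\<in>UNIV. W $ i $ j * y j)"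
    and l: "(l, i) \<in> E"
  shows "y l = M"
proof -
  have "W $ i $ l * (M - y l) \<le> 0"
    using row_stochastic_sum_le_strict[of E W i y M l, OF adj rs le l] M by simp
  moreover have "W $ i $ l > 0" using adj l by (simp add: weighted_adjacency_def)
  ultimately have "M - y l \<le> 0" by (simp add: mult_le_0_iff)
  then show ?thesis using le[OF l] by simp
qed

text \<open>On \<open>C\<close> the maximum \<open>M k\<close> decreases and the minimum
  \<open>m k\<close> increases. Every node is reached from a minimiser by a walk of length
  \<open>N\<close>, so within \<open>N\<close> steps the maximum drops by at least a fixed fraction
  of the spread \<open>M k - m k\<close>. Hence both bounds have the same limit.\<close>

lemma primitive_averaging_convergent:
  fixes W :: "real^'n::finite^'n" and y :: "nat \<Rightarrow> 'n \<Rightarrow> real"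
  assumes adj: "weighted_adjacency E W" and rs: "row_stochastic W"
    and closed: "pred_closed E C" and "C \<noteq> {}"
    and step: "\<And>k i. i \<in> C \<Longrightarrow> y (Suc k) i = (\<Sum>j\<in>UNIV. W $ i $ j * y k j)"
    and N: "\<And>i j. i \<in> C \<Longrightarrow> j \<in> C \<Longrightarrow> (i, j) \<in> E ^^ N"
    and i: "i \<in> C"
  shows "convergent (\<lambda>k. y k i)"
proof -
  define M where "M k = Max (y k ` C)" for k
  define m where "m k = Min (y k ` C)" for k
  have y_le: "y k j \<le> M k" and le_y: "m k \<le> y k j" if "j \<in> C" for k j
    using that by (auto simp: M_def m_def)
  have mM: "m k \<le> M k" for k using y_le[OF i, of k] le_y[OF i, of k] by simp
  have bound: "y (Suc k) j \<le> c" if "j \<in> C" "\<And>l. l \<in> C \<Longrightarrow> y k l \<le> c" for j k c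
    unfolding step[OF that(1)]
    by (rule row_stochastic_sum_le[OF adj rs]) (use that closed in \<open>auto dest: pred_closedD\<close>)
  have bound': "c \<le> y (Suc k) j" if "j \<in> C" "\<And>l. l \<in> C \<Longrightarrow> c \<le> y k l" for j k c
  proof -
    \<comment> \<open>The lower bound is the upper bound for the negated values.\<close>
    have "(\<Sum>l\<in>UNIV. W $ j $ l * - y k l) \<le> - c"
      by (rule row_stochastic_sum_le[OF adj rs]) (use that closed in \<open>auto dest: pred_closedD\<close>)
    then show ?thesis by (simp add: step[OF that(1)] sum_negf)
  qed
  have "decseq M"
    unfolding decseq_Suc_iff using \<open>C \<noteq> {}\<close> bound y_le by (subst M_def) auto
  have "incseq m"
    unfolding incseq_Suc_iff using \<open>C \<noteq> {}\<close> bound' le_y by (subst (2) m_def) auto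
  have "m 0 \<le> M k" for k
    using incseqD[OF \<open>incseq m\<close>, of 0 k] mM[of k] by simp
  then obtain M' where M': "M \<longlonglongrightarrow> M'" using decseq_convergent[OF \<open>decseq M\<close>] by metis
  have "m k \<le> M 0" for k
    using decseqD[OF \<open>decseq M\<close>, of 0 k] mM[of k] by simp
  then obtain m' where m': "m \<longlonglongrightarrow> m'" using incseq_convergent[OF \<open>incseq m\<close>] by metis
  \<comment> \<open>\<open>\<delta>\<close> is a common lower bound for the weights of all edges;
    the inserted 1 keeps the set under \<open>Min\<close> nonempty.\<close>
  obtain \<delta> where \<delta>: "\<delta> > 0" "\<And>i j. (j, i) \<in> E \<Longrightarrow> \<delta> \<le> W $ i $ j"
  proof
    let ?A = "insert 1 ((\<lambda>(j, i). W $ i $ j) ` E)"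
    show "Min ?A > 0" using adj by (auto simp: weighted_adjacency_def)
    show "Min ?A \<le> W $ i $ j" if "(j, i) \<in> E" for i j
      using that by (intro Min_le) force+
  qed
  have later: "y (k + n) l \<le> M k" if "l \<in> C" for k n l
    using y_le[OF that, of "k + n"] decseqD[OF \<open>decseq M\<close>, of k "k + n"] by simp
  \<comment> \<open>Gaps are measured from the fixed earlier maximum \<open>M k\<close>. Each edge
    of the walk passes on at least the fraction \<open>\<delta>\<close> of the gap at its
    tail.\<close>
  have contract: "y (k + n) l \<le> M k - \<delta> ^ n * (M k - y k j)"
    if "(j, l) \<in> E ^^ n" "l \<in> C" for k n j l
    using that
  proof (induction n arbitrary: l)
    case 0
    then show ?case by simp
  next
    case (Suc n)
    then obtain h where h: "(j, h) \<in> E ^^ n" "(h, l) \<in> E" by auto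
    then have hC: "h \<in> C" using closed Suc.prems by (auto dest: pred_closedD)
    have IH: "y (k + n) h \<le> M k - \<delta> ^ n * (M k - y k j)" using Suc.IH h hC by blast
    have jC: "j \<in> C"
      using pred_closed_rtrancl[OF closed relpow_imp_rtrancl[OF h(1)] hC] .
    have "y (k + Suc n) l \<le> M k - W $ l $ h * (M k - y (k + n) h)"
      using step[OF Suc.prems(2), of "k + n"] closed Suc.prems
      by (simp, intro row_stochastic_sum_le_strict[OF adj rs _ h(2)] later)
        (auto dest: pred_closedD)
    also have "\<dots> \<le> M k - \<delta> * (\<delta> ^ n * (M k - y k j))"
    proof -
      have "\<delta> * (\<delta> ^ n * (M k - y k j)) \<le> W $ l $ h * (M k - y (k + n) h)"
        using \<delta> h(2) IH y_le[OF jC, of k] less_imp_le[OF \<delta>(1)] later[OF hC, of k n]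
        by (intro mult_mono) (auto intro!: order_trans[OF _ \<delta>(2)])
      then show ?thesis by simp
    qed
    finally show ?case by (simp add: mult.assoc)
  qed
  have "M (k + N) \<le> M k - \<delta> ^ N * (M k - m k)" for k
  proof -
    have "m k \<in> y k ` C" unfolding m_def using \<open>C \<noteq> {}\<close> by (intro Min_in) auto
    then obtain j where "j \<in> C" "m k = y k j" by auto
    then show ?thesis
      using contract[OF N] \<open>C \<noteq> {}\<close> by (subst M_def) auto
  qed
  then have "M' \<le> M' - \<delta> ^ N * (M' - m')"
    by (intro LIMSEQ_le[OF LIMSEQ_ignore_initial_segment[OF M', of N], of "\<lambda>k. M k - \<delta> ^ N * (M k - m k)"])
      (auto intro!: tendsto_intros M' m')
  then have "M' \<le> m'" using zero_less_power[OF \<delta>(1), of N] by (simp add: mult_le_0_iff)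
  moreover have "m' \<le> M'" using LIMSEQ_le[OF m' M'] mM by blast
  ultimately have "m' = M'" by simp
  then have "(\<lambda>k. y k i) \<longlonglongrightarrow> M'"
    using m' M' y_le[OF i] le_y[OF i]
    by (intro tendsto_sandwich[of m "\<lambda>k. y k i" sequentially M]) auto
  then show ?thesis by (auto simp: convergent_def)
qed

section \<open>Oscillation\<close>

text \<open>For bounded \<open>f\<close> this decreases in \<open>k\<close> to the difference of
  limsup and liminf. It measures failure of convergence without reference to a limit.\<close>

definition tail_osc :: "(nat \<Rightarrow> real) \<Rightarrow> nat \<Rightarrow> real" where
  "tail_osc f k = (SUP (m, n)\<in>{k..} \<times> {k..}. \<bar>f m - f n\<bar>)"

context
  fixes f :: "nat \<Rightarrow> real" and B :: real
  assumes bounded: "\<And>k. \<bar>f k\<bar> \<le> B"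
begin

lemma diff_le_tail_osc:
  assumes "k \<le> m" "k \<le> n"
  shows "\<bar>f m - f n\<bar> \<le> tail_osc f k"
proof -
  have "\<bar>f m - f n\<bar> \<le> 2 * B" for m n
    using bounded[of m] bounded[of n] by linarith
  then have "bdd_above ((\<lambda>(m, n). \<bar>f m - f n\<bar>) ` ({k..} \<times> {k..}))"
    by (auto intro!: bdd_aboveI[of _ "2 * B"])
  then have "(\<lambda>(m, n). \<bar>f m - f n\<bar>) (m, n) \<le> tail_osc f k"
    unfolding tail_osc_def by (intro cSUP_upper) (use assms in auto)
  then show ?thesis by simp
qed

lemma tail_osc_nonneg: "0 \<le> tail_osc f k"
  using diff_le_tail_osc[of k k k] by simp

lemma tail_osc_tendsto_lim: "tail_osc f \<longlonglongrightarrow> lim (tail_osc f)"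
proof -
  have "decseq (tail_osc f)"
    unfolding decseq_def
  proof (intro allI impI)
    fix k l :: nat assume "k \<le> l"
    then show "tail_osc f l \<le> tail_osc f k"
      unfolding tail_osc_def[of f l] by (intro cSUP_least) (auto intro: diff_le_tail_osc)
  qed
  then have "convergent (tail_osc f)"
    using decseq_convergent[of "tail_osc f" 0] tail_osc_nonneg by (metis convergentI)
  then show ?thesis by (simp add: convergent_LIMSEQ_iff)
qed

lemma lim_tail_osc_nonneg: "0 \<le> lim (tail_osc f)"
  by (rule LIMSEQ_le_const[OF tail_osc_tendsto_lim]) (auto intro: tail_osc_nonneg)

text \<open>This is the Cauchy criterion, with completeness of the reals.\<close>

lemma convergent_iff_lim_tail_osc: "convergent f \<longleftrightarrow> lim (tail_osc f) = 0"
proof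
  assume "convergent f"
  then have "Cauchy f" by (rule convergent_Cauchy)
  have "lim (tail_osc f) \<le> e" if "e > 0" for e
  proof -
    obtain K where K: "\<And>m n. m \<ge> K \<Longrightarrow> n \<ge> K \<Longrightarrow> \<bar>f m - f n\<bar> < e"
      using \<open>Cauchy f\<close> \<open>e > 0\<close> unfolding Cauchy_def dist_real_def by meson
    have "tail_osc f n \<le> e" if "n \<ge> K" for n
      unfolding tail_osc_def
      by (rule cSUP_least) (use K that in \<open>auto intro!: less_imp_le\<close>)
    then show ?thesis by (intro LIMSEQ_le_const2[OF tail_osc_tendsto_lim]) blast
  qed
  then have "lim (tail_osc f) \<le> 0" by (rule field_le_epsilon[of _ 0, simplified])
  then show "lim (tail_osc f) = 0" using lim_tail_osc_nonneg by simp
next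
  assume "lim (tail_osc f) = 0"
  then have 0: "tail_osc f \<longlonglongrightarrow> 0" using tail_osc_tendsto_lim by simp
  have "Cauchy f"
  proof (rule CauchyI)
    fix e :: real assume "e > 0"
    then obtain K where "tail_osc f K < e"
      using order_tendstoD(2)[OF 0] by (auto simp: eventually_sequentially)
    then show "\<exists>K. \<forall>m\<ge>K. \<forall>n\<ge>K. norm (f m - f n) < e"
      using diff_le_tail_osc by (auto intro!: exI[of _ K] intro: le_less_trans)
  qed
  then show "convergent f" by (rule Cauchy_convergent)
qed

end

section \<open>The Friedkin-Johnsen model\<close>

lemma FJ_opinion_Suc_nth:
  "FJ_opinion W \<beta> x0 (Suc k) $ i
    = (1 - \<beta> $ i) * (\<Sum>j\<in>UNIV. W $ i $ j * FJ_opinion W \<beta> x0 k $ j) + \<beta> $ i * x0 $ i"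
proof -
  have diag: "(diag_matrix \<beta> *v v) $ i = \<beta> $ i * v $ i" for v
    by (simp add: matrix_vector_mult_def diag_matrix_def if_distrib[of "\<lambda>x. x * _"] cong: if_cong)
  show ?thesis
    by (simp add: diag matrix_vector_mult_diff_rdistrib flip: matrix_vector_mul_assoc)
      (simp add: matrix_vector_mult_def algebra_simps)
qed

context
  fixes E :: "('n::finite \<times> 'n) set" and W :: "real^'n^'n" and \<beta> :: "real^'n"
  assumes adj: "weighted_adjacency E W" and rs: "row_stochastic W"
    and \<beta>: "\<forall>i. 0 \<le> \<beta> $ i \<and> \<beta> $ i \<le> 1"
begin

text \<open>Each update is a convex combination of an average of current opinions and an initial
  opinion, and \<open>norm x0\<close> bounds all entries of \<open>x0\<close>.\<close>

lemma FJ_opinion_bounded: "\<bar>FJ_opinion W \<beta> x0 k $ i\<bar> \<le> norm x0"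
proof (induction k arbitrary: i)
  case 0
  show ?case by (simp add: component_le_norm_cart)
next
  case (Suc k)
  have "\<bar>\<Sum>j\<in>UNIV. W $ i $ j * FJ_opinion W \<beta> x0 k $ j\<bar>
      \<le> (\<Sum>j\<in>UNIV. W $ i $ j * \<bar>FJ_opinion W \<beta> x0 k $ j\<bar>)"
    using rs by (intro order_trans[OF sum_abs]) (auto simp: row_stochastic_def abs_mult intro!: sum_mono)
  also have "\<dots> \<le> norm x0" by (rule row_stochastic_sum_le[OF adj rs]) (rule Suc.IH)
  finally have s: "\<bar>\<Sum>j\<in>UNIV. W $ i $ j * FJ_opinion W \<beta> x0 k $ j\<bar> \<le> norm x0" .
  have "\<bar>FJ_opinion W \<beta> x0 (Suc k) $ i\<bar> \<le> (1 - \<beta> $ i) * norm x0 + \<beta> $ i * norm x0"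
    unfolding FJ_opinion_Suc_nth using \<beta> s
    by (intro order_trans[OF abs_triangle_ineq] add_mono)
      (auto simp: abs_mult component_le_norm_cart intro!: mult_left_mono)
  then show ?case by (simp add: algebra_simps)
qed

text \<open>Without stubborn agents the update on \<open>C\<close> is pure averaging, so primitivity
  gives convergence.\<close>

lemma FJ_opinion_convergent_aperiodic:
  assumes "pred_closed E C" "C \<inter> stubborn \<beta> = {}"
    and "\<And>u v. u \<in> C \<Longrightarrow> v \<in> C \<Longrightarrow> (u, v) \<in> E\<^sup>*"
    and "aperiodic (network E \<restriction> C)" "i \<in> C"
  shows "convergent (\<lambda>k. FJ_opinion W \<beta> x0 k $ i)"
proof -
  let ?H = "network E \<restriction> C"
  \<comment> \<open>Passing to all closed walks of \<open>E\<close> at nodes of \<open>C\<close>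
    enlarges the set of lengths, so its gcd still divides 1. The larger set also contains 0, which
    does not affect the gcd.\<close>
  have "{length c | c. \<exists>u. pre_digraph.awalk ?H u c u \<and> c \<noteq> []} \<subseteq> {k. \<exists>v\<in>C. (v, v) \<in> E ^^ k}"
  proof clarify
    fix c u assume c: "pre_digraph.awalk ?H u c u"
    then have "u \<in> C" by (simp add: pre_digraph.awalk_def)
    moreover have "(u, u) \<in> E ^^ length c"
      using awalk_imp_relpow[OF c, of E] by (auto simp: induce_subgraph_def)
    ultimately show "\<exists>v\<in>C. (v, v) \<in> E ^^ length c" by blast
  qed
  then have "Gcd {k. \<exists>v\<in>C. (v, v) \<in> E ^^ k}
      dvd Gcd {length c | c. \<exists>u. pre_digraph.awalk ?H u c u \<and> c \<noteq> []}"
    by (intro Gcd_greatest Gcd_dvd) (rule subsetD)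
  then have "Gcd {k. \<exists>v\<in>C. (v, v) \<in> E ^^ k} = 1"
    using assms(4) by (simp add: aperiodic_def)
  then obtain N where "\<And>i j. i \<in> C \<Longrightarrow> j \<in> C \<Longrightarrow> (i, j) \<in> E ^^ N"
    using aperiodic_imp_primitive[OF assms(3)] assms(5) by blast
  moreover have "FJ_opinion W \<beta> x0 (Suc k) $ j = (\<Sum>l\<in>UNIV. W $ j $ l * FJ_opinion W \<beta> x0 k $ l)"
    if "j \<in> C" for j k
  proof -
    have "\<beta> $ j = 0" using \<beta>[rule_format, of j] that assms(2) by (auto simp: stubborn_def)
    then show ?thesis unfolding FJ_opinion_Suc_nth by simp
  qed
  ultimately show ?thesis
    using primitive_averaging_convergent[OF adj rs assms(1), of "\<lambda>k j. FJ_opinion W \<beta> x0 k $ j"]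
      assms(5) by blast
qed

lemma FJ_opinion_convergent:
  assumes aper: "\<forall>H\<in>isccs E. verts H \<subseteq> oblivious E \<beta> \<longrightarrow> aperiodic H"
  shows "convergent (\<lambda>k. FJ_opinion W \<beta> x0 k $ i)"
proof -
  define x where "x i k = FJ_opinion W \<beta> x0 k $ i" for i k
  define D where "D i = lim (tail_osc (x i))" for i
  have bd: "\<bar>x i k\<bar> \<le> norm x0" for i k unfolding x_def by (rule FJ_opinion_bounded)
  note osc_le = diff_le_tail_osc[of "x i" "norm x0" for i, OF bd]
  have D0: "0 \<le> D i" and conv: "convergent (x i) \<longleftrightarrow> D i = 0"
    and D_lim: "tail_osc (x i) \<longlonglongrightarrow> D i" for i
    using lim_tail_osc_nonneg[of "x i" "norm x0", OF bd]
      convergent_iff_lim_tail_osc[of "x i" "norm x0", OF bd]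
      tail_osc_tendsto_lim[of "x i" "norm x0", OF bd]
    by (simp_all add: D_def)
  have step: "tail_osc (x i) (Suc k) \<le> (1 - \<beta> $ i) * (\<Sum>j\<in>UNIV. W $ i $ j * tail_osc (x j) k)" for i k
    unfolding tail_osc_def[of "x i"]
  proof (rule cSUP_least; clarsimp)
    fix m n assume "Suc k \<le> m" "Suc k \<le> n"
    then obtain m' n' where mn: "m = Suc m'" "n = Suc n'" "k \<le> m'" "k \<le> n'"
      by (metis Suc_le_D Suc_le_mono)
    \<comment> \<open>Both times are successors, so the constant term with \<open>x0\<close>
      cancels.\<close>
    have "x i m - x i n = (1 - \<beta> $ i) * (\<Sum>j\<in>UNIV. W $ i $ j * (x j m' - x j n'))"
      unfolding x_def mn FJ_opinion_Suc_nth by (simp add: right_diff_distrib sum_subtractf)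
    then have "\<bar>x i m - x i n\<bar> = (1 - \<beta> $ i) * \<bar>\<Sum>j\<in>UNIV. W $ i $ j * (x j m' - x j n')\<bar>"
      using \<beta> by (simp add: abs_mult)
    also have "\<dots> \<le> (1 - \<beta> $ i) * (\<Sum>j\<in>UNIV. W $ i $ j * tail_osc (x j) k)"
      using \<beta> rs mn
      by (intro mult_left_mono order_trans[OF sum_abs] sum_mono)
        (auto simp: abs_mult row_stochastic_def intro!: mult_left_mono osc_le)
    finally show "\<bar>x i m - x i n\<bar> \<le> (1 - \<beta> $ i) * (\<Sum>j\<in>UNIV. W $ i $ j * tail_osc (x j) k)" .
  qed
  have D_le: "D i \<le> (1 - \<beta> $ i) * (\<Sum>j\<in>UNIV. W $ i $ j * D j)" for i
  proof (rule LIMSEQ_le)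
    show "(\<lambda>k. tail_osc (x i) (Suc k)) \<longlonglongrightarrow> D i" by (rule LIMSEQ_Suc[OF D_lim])
    show "(\<lambda>k. (1 - \<beta> $ i) * (\<Sum>j\<in>UNIV. W $ i $ j * tail_osc (x j) k))
        \<longlonglongrightarrow> (1 - \<beta> $ i) * (\<Sum>j\<in>UNIV. W $ i $ j * D j)"
      by (intro tendsto_intros D_lim)
  qed (use step in blast)
  define M where "M = Max (range D)"
  have D_M: "D i \<le> M" for i by (simp add: M_def)
  have "M \<le> 0"
  proof (rule ccontr)
    assume "\<not> M \<le> 0"
    define S where "S = {i. D i = M}"
    \<comment> \<open>At a maximiser, \<open>M \<le> (1 - \<beta> $ i) * M\<close> with
      \<open>M > 0\<close> forces \<open>\<beta> $ i = 0\<close>; the average is then at least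
      \<open>M\<close>.\<close>
    have M_le: "M \<le> (\<Sum>j\<in>UNIV. W $ i $ j * D j)" and nonstub: "\<beta> $ i = 0" if "i \<in> S" for i
    proof -
      let ?s = "\<Sum>j\<in>UNIV. W $ i $ j * D j"
      have s: "?s \<le> M" by (rule row_stochastic_sum_le[OF adj rs D_M])
      have "M \<le> (1 - \<beta> $ i) * ?s" using D_le[of i] that by (simp add: S_def)
      also have "\<dots> \<le> (1 - \<beta> $ i) * M" using s \<beta> by (intro mult_left_mono) auto
      finally have "\<beta> $ i * M \<le> 0" by (simp add: algebra_simps)
      then show "\<beta> $ i = 0" using \<beta> \<open>\<not> M \<le> 0\<close> by (simp add: mult_le_0_iff antisym)
      then show "M \<le> ?s" using \<open>M \<le> (1 - \<beta> $ i) * ?s\<close> by simp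
    qed
    have "pred_closed E S"
      unfolding pred_closed_def
    proof (intro allI impI)
      fix l i assume "(l, i) \<in> E" "i \<in> S"
      then have "D l = M" using row_stochastic_sum_max_eq[OF adj rs D_M M_le] by blast
      then show "l \<in> S" by (simp add: S_def)
    qed
    moreover have "S \<noteq> {}"
    proof -
      have "M \<in> range D" unfolding M_def by (rule Max_in) auto
      then show ?thesis by (auto simp: S_def)
    qed
    ultimately obtain C where C: "network E \<restriction> C \<in> isccs E" "C \<subseteq> S" "C \<noteq> {}" "pred_closed E C"
      "\<And>u v. u \<in> C \<Longrightarrow> v \<in> C \<Longrightarrow> (u, v) \<in> E\<^sup>*"
      by (rule pred_closed_contains_iscc) blast
    have stub: "C \<inter> stubborn \<beta> = {}" using C(2) nonstub by (force simp: stubborn_def)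
    then have "aperiodic (network E \<restriction> C)"
      using aper C pred_closed_oblivious by (metis induce_subgraph_verts)
    moreover obtain c where "c \<in> C" using C(3) by blast
    ultimately have "convergent (x c)"
      unfolding x_def using FJ_opinion_convergent_aperiodic[OF C(4) stub C(5)] by blast
    then show False using conv \<open>c \<in> C\<close> C(2) \<open>\<not> M \<le> 0\<close> by (auto simp: S_def)
  qed
  then have "D i = 0" using D0[of i] D_M[of i] by simp
  then show ?thesis using conv[of i] by (simp add: x_def[abs_def])
qed

text \<open>Here \<open>y\<close> is any function with the averaging property on the persuaded
  agents, so that the lemma can be applied to the final opinions and to their negatives.\<close>

lemma persuaded_average_le:
  assumes avg: "\<And>q. q \<in> persuaded E \<beta> p \<Longrightarrow> y q = (\<Sum>j\<in>UNIV. W $ q $ j * y j)"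
    and q: "q \<in> persuaded E \<beta> p"
  shows "y q \<le> y p"
proof (rule ccontr)
  assume less: "\<not> y q \<le> y p"
  let ?N = "persuaded E \<beta> p"
  define M where "M = Max (y ` ?N)"
  define S where "S = {i \<in> ?N. y i = M}"
  have le_M: "y i \<le> M" if "i \<in> ?N" for i using that by (simp add: M_def)
  have "y p < M" using less le_M[OF q] by simp
  have "pred_closed E S"
    unfolding pred_closed_def
  proof (intro allI impI)
    fix l i assume l: "(l, i) \<in> E" and i: "i \<in> S"
    have "y j \<le> M" if "(j, i) \<in> E" for j
      using in_neighbour_persuaded[OF _ that] i le_M \<open>y p < M\<close> by (force simp: S_def)
    moreover have "M \<le> (\<Sum>j\<in>UNIV. W $ i $ j * y j)" using avg[of i] i by (simp add: S_def)
    ultimately have "y l = M" using row_stochastic_sum_max_eq[OF adj rs _ _ l, of y M] by blast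
    \<comment> \<open>The in-neighbour \<open>l\<close> is \<open>p\<close> or persuaded, and
      \<open>y p < M\<close> rules out \<open>p\<close>.\<close>
    then show "l \<in> S"
      using in_neighbour_persuaded[OF _ l] i \<open>y p < M\<close> by (auto simp: S_def)
  qed
  moreover have "S \<noteq> {}"
  proof -
    have "M \<in> y ` ?N" unfolding M_def using q by (intro Max_in) auto
    then show ?thesis by (auto simp: S_def)
  qed
  ultimately have "S \<inter> influential E \<beta> \<noteq> {}" by (rule pred_closed_contains_influential)
  then show False by (auto simp: S_def persuaded_def)
qed

end

theorem theorem1:
  fixes E :: "('n::finite \<times> 'n) set"
    and W :: "real^'n^'n"
    and \<beta> :: "real^'n"
    and m :: nat
    and p :: 'n
  assumes "weighted_adjacency E W"
    and "row_stochastic W"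
    and "\<forall>i. 0 \<le> \<beta> $ i \<and> \<beta> $ i \<le> 1"
    and "card (stubborn \<beta>) = m"
    and "\<forall>H\<in>isccs E. verts H \<subseteq> oblivious E \<beta> \<longrightarrow> aperiodic H"
    and "LTP_agent E \<beta> p"
  shows "opinion_cluster W \<beta> ({p} \<union> persuaded E \<beta> p)"
proof -
  have conv: "convergent (\<lambda>k. FJ_opinion W \<beta> x0 k $ i)" for x0 i
    by (rule FJ_opinion_convergent[OF assms(1-3,5)])
  have "final_opinion W \<beta> x0 q = final_opinion W \<beta> x0 p" if "q \<in> persuaded E \<beta> p" for x0 q
  proof -
    define y where "y = final_opinion W \<beta> x0"
    have y: "(\<lambda>k. FJ_opinion W \<beta> x0 k $ i) \<longlonglongrightarrow> y i" for i
      using conv[of x0 i] by (simp add: y_def final_opinion_def convergent_LIMSEQ_iff)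
    have avg: "y r = (\<Sum>j\<in>UNIV. W $ r $ j * y j)" if "r \<in> persuaded E \<beta> p" for r
    proof -
      have "\<beta> $ r = 0"
        using that assms(3)[rule_format, of r]
        by (auto simp: persuaded_def influential_def stubborn_def)
      \<comment> \<open>A persuaded agent is not stubborn, so the limit of its update is the plain
        average of the final opinions.\<close>
      then have "(\<lambda>k. FJ_opinion W \<beta> x0 (Suc k) $ r) \<longlonglongrightarrow> (\<Sum>j\<in>UNIV. W $ r $ j * y j)"
        unfolding FJ_opinion_Suc_nth by (auto intro!: tendsto_intros y)
      then show ?thesis using LIMSEQ_Suc[OF y[of r]] LIMSEQ_unique by blast
    qed
    have "y q \<le> y p"
      by (rule persuaded_average_le[OF assms(1-3) avg that])
    moreover have "- y q \<le> - y p"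
    proof (rule persuaded_average_le[OF assms(1-3) _ that])
      show "- y r = (\<Sum>j\<in>UNIV. W $ r $ j * - y j)" if "r \<in> persuaded E \<beta> p" for r
        using avg[OF that] by (simp add: sum_negf)
    qed
    ultimately show ?thesis by (simp add: y_def)
  qed
  then show ?thesis using conv by (auto simp: opinion_cluster_def)
qed

end
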